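(* Let $F_A$ be the free group on a finite set $A$, let $d \in V^A(p,\gamma,T)$ be a visual metric on $F_A$ (with $p\in F_A$, $\gamma>0$, $T\ge 1$) and let $\varphi \in \mathrm{Aut}(F_A)$. Then the following conditions are equivalent: (i) $\varphi$ satisfies a Lipschitz condition (with respect to $d$); (ii) $\varphi \in \langle \mathrm{Inn}(F_A) \cup \mathrm{Per}^A(F_A) \rangle = \mathrm{Per}^A(F_A)\,\mathrm{Inn}(F_A)$.
   Context: Maps are written on the right. $\widetilde{A} = A \cup A^{-1}$, and $d_A(g,h)$ is the word metric on $F_A$ with respect to $A$ (the length of the reduced word over $\widetilde{A}$ representing $g^{-1}h$). Gromov product: $(g|h)_p^A = \frac12(d_A(p,g)+d_A(p,h)-d_A(g,h))$. Let $\rho^A_{p,\gamma}(g,h) = e^{-\gamma (g|h)_p^A}$ if $g \ne h$ and $0$ otherwise. $V^A(p,\gamma,T)$ is the set of all metrics $d$ on $F_A$ with $\frac1T\rho^A_{p,\gamma}(g,h) \le d(g,h) \le T\rho^A_{p,\gamma}(g,h)$ for all distinct $g,h$; its elements are visual metrics. $\varphi$ satisfies a Lipschitz condition with respect to $d$ if there is $K>0$ with $d(g\varphi,h\varphi)\le K\,d(g,h)$ for all $g,h$. $\mathrm{Inn}(F_A)$ is the group of inner automorphisms of $F_A$. $\mathrm{Per}^A(F_A)$ is the group of permutation automorphisms with respect to $A$, i.e. those $\varphi\in\mathrm{Aut}(F_A)$ such that $\varphi|_{\widetilde{A}}$ is a permutation of $\widetilde{A}$. *)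

theory Defs
  imports "HOL-Analysis.Analysis" "HOL-Algebra.Bij" "HOL-Algebra.Generated_Groups"
begin

section \<open>Free groups as groups of reduced words\<close>

text \<open>The letter \<open>(a, True)\<close> stands for the generator \<open>a\<close>, the letter \<open>(a, False)\<close> for its
  formal inverse.\<close>

type_synonym 'a word = "('a \<times> bool) list"

definition letter_inv :: "'a \<times> bool \<Rightarrow> 'a \<times> bool" where
  "letter_inv x = (fst x, \<not> snd x)"

definition reduced_word :: "'a word \<Rightarrow> bool" where
  "reduced_word w \<longleftrightarrow> successively (\<lambda>x y. y \<noteq> letter_inv x) w"

fun cons_red :: "'a \<times> bool \<Rightarrow> 'a word \<Rightarrow> 'a word" where
  "cons_red x [] = [x]"
| "cons_red x (y # w) = (if y = letter_inv x then w else x # y # w)"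

definition reduce :: "'a word \<Rightarrow> 'a word" where
  "reduce w = foldr cons_red w []"

definition free_group :: "'a set \<Rightarrow> 'a word monoid" where
  "free_group A =
    \<lparr>carrier = {w. reduced_word w \<and> set w \<subseteq> A \<times> UNIV},
     mult = (\<lambda>u v. reduce (u @ v)),
     one = []\<rparr>"

definition gen :: "'a \<Rightarrow> 'a word" where
  "gen a = [(a, True)]"

definition sym_gens :: "'a set \<Rightarrow> 'a word set" where
  "sym_gens A = gen ` A \<union> (\<lambda>a. inv\<^bsub>free_group A\<^esub> gen a) ` A"

subsection \<open>It is a group\<close>

lemma letter_inv_letter_inv [simp]: "letter_inv (letter_inv x) = x"
  by (simp add: letter_inv_def)

lemma letter_inv_eq_iff: "letter_inv x = y \<longleftrightarrow> x = letter_inv y"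
  by auto

lemma reduced_Nil [simp]: "reduced_word []"
  by (simp add: reduced_word_def)

lemma reduced_Cons: "reduced_word (x # w) \<longleftrightarrow> reduced_word w \<and> (w = [] \<or> hd w \<noteq> letter_inv x)"
  by (cases w) (auto simp: reduced_word_def)

lemma reduced_cons_red: "reduced_word w \<Longrightarrow> reduced_word (cons_red x w)"
  by (cases w) (auto simp: reduced_Cons)

lemma reduced_foldr: "reduced_word w \<Longrightarrow> reduced_word (foldr cons_red u w)"
  by (induction u) (auto intro: reduced_cons_red)

lemma reduced_reduce: "reduced_word (reduce w)"
  by (simp add: reduce_def reduced_foldr)

lemma reduce_id: "reduced_word w \<Longrightarrow> reduce w = w"
  unfolding reduce_def
proof (induction w)
  case (Cons x w)
  then show ?case by (cases w) (auto simp: reduced_Cons)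
qed simp

lemma cons_red_cancel: "reduced_word w \<Longrightarrow> cons_red x (cons_red (letter_inv x) w) = w"
  by (cases w rule: remdups_adj.cases) (auto simp: reduced_Cons)

lemma foldr_cons_red:
  assumes "reduced_word w"
  shows "foldr cons_red (cons_red x u) w = cons_red x (foldr cons_red u w)"
proof (cases u)
  case (Cons y v)
  then show ?thesis
    using cons_red_cancel [OF reduced_foldr [OF assms]] by auto
qed simp

lemma foldr_reduce: "reduced_word w \<Longrightarrow> foldr cons_red (reduce u) w = foldr cons_red u w"
  by (induction u) (auto simp: reduce_def foldr_cons_red)

lemma reduce_append: "reduce (u @ v) = foldr cons_red u (reduce v)"
  by (simp add: reduce_def)

lemma reduce_append_left: "reduce (reduce u @ v) = reduce (u @ v)"
  by (simp add: reduce_append foldr_reduce reduced_reduce)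

lemma reduce_append_right: "reduce (u @ reduce v) = reduce (u @ v)"
  by (simp add: reduce_append reduce_id reduced_reduce)

lemma set_cons_red: "set (cons_red x w) \<subseteq> insert x (set w)"
  by (cases w) auto

lemma set_reduce: "set (reduce w) \<subseteq> set w"
  unfolding reduce_def
proof (induction w)
  case (Cons x w)
  then show ?case using set_cons_red [of x "foldr cons_red w []"] by auto
qed simp

lemma reduce_inverse: "reduce (rev (map letter_inv w) @ w) = []"
proof (induction w)
  case (Cons x w)
  have "reduce (rev (map letter_inv (x # w)) @ x # w)
      = foldr cons_red (rev (map letter_inv w)) (cons_red (letter_inv x) (cons_red x (reduce w)))"
    by (simp add: reduce_def)
  also have "\<dots> = reduce (rev (map letter_inv w) @ w)"
    using cons_red_cancel [OF reduced_reduce, of "letter_inv x"] by (simp add: reduce_append)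
  finally show ?case using Cons by simp
qed (simp add: reduce_def)

lemma reduced_inverse: "reduced_word w \<Longrightarrow> reduced_word (rev (map letter_inv w))"
  by (auto simp: reduced_word_def successively_map letter_inv_def prod_eq_iff
      elim!: successively_mono)

lemma group_free_group: "group (free_group A)"
proof (rule groupI)
  fix u v assume "u \<in> carrier (free_group A)" "v \<in> carrier (free_group A)"
  then show "u \<otimes>\<^bsub>free_group A\<^esub> v \<in> carrier (free_group A)"
    using set_reduce [of "u @ v"] by (auto simp: free_group_def reduced_reduce)
next
  fix w assume w: "w \<in> carrier (free_group A)"
  then have "rev (map letter_inv w) \<in> carrier (free_group A)"
    by (auto simp: free_group_def reduced_inverse letter_inv_def)
  then show "\<exists>v\<in>carrier (free_group A). v \<otimes>\<^bsub>free_group A\<^esub> w = \<one>\<^bsub>free_group A\<^esub>"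
    using reduce_inverse [of w] by (intro bexI [of _ "rev (map letter_inv w)"]) (simp add: free_group_def)
qed (auto simp: free_group_def reduce_id reduce_append_left reduce_append_right)

lemma inv_free_group:
  assumes "w \<in> carrier (free_group A)"
  shows "inv\<^bsub>free_group A\<^esub> w = rev (map letter_inv w)"
proof (rule group.inv_equality [OF group_free_group])
  show "rev (map letter_inv w) \<otimes>\<^bsub>free_group A\<^esub> w = \<one>\<^bsub>free_group A\<^esub>"
    using reduce_inverse [of w] by (simp add: free_group_def)
  show "rev (map letter_inv w) \<in> carrier (free_group A)"
    using assms by (auto simp: free_group_def reduced_inverse letter_inv_def)
qed (use assms in simp)

lemma sym_gens_eq: "sym_gens A = (\<lambda>x. [x]) ` (A \<times> UNIV)"
proof -
  have g: "gen a \<in> carrier (free_group A)" if "a \<in> A" for a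
    using that by (simp add: free_group_def gen_def reduced_Cons)
  have "inv\<^bsub>free_group A\<^esub> gen a = [(a, False)]" if "a \<in> A" for a
    using inv_free_group [OF g [OF that]] by (simp add: gen_def letter_inv_def)
  then show ?thesis
    by (force simp: sym_gens_def gen_def image_iff)
qed

subsection \<open>Universal property\<close>

definition eval_word :: "('g, 'm) monoid_scheme \<Rightarrow> ('a \<Rightarrow> 'g) \<Rightarrow> 'a word \<Rightarrow> 'g" where
  "eval_word G f w = foldr (\<lambda>(a, b) g. (if b then f a else inv\<^bsub>G\<^esub> f a) \<otimes>\<^bsub>G\<^esub> g) w \<one>\<^bsub>G\<^esub>"

lemma (in group) eval_word_Cons:
  "eval_word G f (x # w) = (if snd x then f (fst x) else inv f (fst x)) \<otimes> eval_word G f w"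
  by (simp add: eval_word_def case_prod_beta)

lemma (in group) eval_word_closed:
  assumes "f \<in> A \<rightarrow> carrier G" "set w \<subseteq> A \<times> UNIV"
  shows "eval_word G f w \<in> carrier G"
  using assms(2)
proof (induction w)
  case (Cons x w)
  moreover from Cons.prems have "f (fst x) \<in> carrier G" using assms(1) by auto
  ultimately show ?case by (simp add: eval_word_Cons)
qed (simp add: eval_word_def)

lemma (in group) eval_word_append:
  assumes f: "f \<in> A \<rightarrow> carrier G" and "set u \<subseteq> A \<times> UNIV" and v: "set v \<subseteq> A \<times> UNIV"
  shows "eval_word G f (u @ v) = eval_word G f u \<otimes> eval_word G f v"
  using assms(2)
proof (induction u)
  case Nil
  then show ?case using eval_word_closed [OF f v] by (simp add: eval_word_def)
next
  case (Cons x u)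
  then have "f (fst x) \<in> carrier G" "eval_word G f u \<in> carrier G"
    using f eval_word_closed [OF f] by auto
  then show ?case
    using Cons eval_word_closed [OF f v] by (simp add: eval_word_Cons m_assoc)
qed

lemma (in group) eval_word_cons_red:
  assumes f: "f \<in> A \<rightarrow> carrier G" and x: "fst x \<in> A" and w: "set w \<subseteq> A \<times> UNIV"
  shows "eval_word G f (cons_red x w) = eval_word G f (x # w)"
proof (cases w)
  case (Cons y v)
  then have "f (fst x) \<in> carrier G" "eval_word G f v \<in> carrier G"
    using f x w eval_word_closed [OF f] by auto
  with Cons show ?thesis
    by (auto simp: eval_word_Cons letter_inv_def m_assoc [symmetric])
qed simp

lemma (in group) eval_word_reduce:
  assumes f: "f \<in> A \<rightarrow> carrier G" and "set w \<subseteq> A \<times> UNIV"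
  shows "eval_word G f (reduce w) = eval_word G f w"
  using assms(2)
proof (induction w)
  case (Cons x w)
  then have "eval_word G f (cons_red x (reduce w)) = eval_word G f (x # reduce w)"
    using set_reduce [of w] by (intro eval_word_cons_red [OF f]) auto
  with Cons show ?case by (simp add: eval_word_Cons reduce_def)
qed (simp add: reduce_def)

theorem (in group) free_group_universal:
  assumes f: "f \<in> A \<rightarrow> carrier G"
  shows "\<exists>!h. h \<in> hom (free_group A) G \<inter> extensional (carrier (free_group A))
      \<and> (\<forall>a\<in>A. h (gen a) = f a)"
proof (intro ex1I)
  let ?F = "free_group A"
  interpret F: group ?F by (rule group_free_group)
  let ?h = "restrict (eval_word G f) (carrier ?F)"
  have car: "set w \<subseteq> A \<times> UNIV" if "w \<in> carrier ?F" for w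
    using that by (simp add: free_group_def)
  have gencar: "gen a \<in> carrier ?F" if "a \<in> A" for a
    using that by (simp add: free_group_def gen_def reduced_Cons)
  have mult: "u \<otimes>\<^bsub>?F\<^esub> v = reduce (u @ v)" for u v
    by (simp add: free_group_def)
  have "?h \<in> hom ?F G"
  proof (rule homI)
    fix u v assume uv: "u \<in> carrier ?F" "v \<in> carrier ?F"
    then have "eval_word G f (u \<otimes>\<^bsub>?F\<^esub> v) = eval_word G f u \<otimes> eval_word G f v"
      using eval_word_reduce [OF f, of "u @ v"] eval_word_append [OF f car car] car
      by (simp add: mult)
    with uv show "?h (u \<otimes>\<^bsub>?F\<^esub> v) = ?h u \<otimes> ?h v" by simp
  qed (use eval_word_closed [OF f car] in simp)
  moreover have "?h (gen a) = f a" if "a \<in> A" for a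
    using funcset_mem [OF f that] gencar [OF that] by (simp add: gen_def eval_word_def)
  ultimately show "?h \<in> hom ?F G \<inter> extensional (carrier ?F) \<and> (\<forall>a\<in>A. ?h (gen a) = f a)"
    by auto
  fix h assume h: "h \<in> hom ?F G \<inter> extensional (carrier ?F) \<and> (\<forall>a\<in>A. h (gen a) = f a)"
  then interpret H: group_hom ?F G h by unfold_locales auto
  have "h w = eval_word G f w" if "w \<in> carrier ?F" for w
    using that
  proof (induction w)
    case Nil
    then show ?case using H.hom_one by (simp add: free_group_def eval_word_def)
  next
    case (Cons x w)
    obtain a b where x: "x = (a, b)" by (cases x)
    have w: "w \<in> carrier ?F" and a: "a \<in> A" and red: "reduced_word (x # w)"
      using Cons.prems x by (auto simp: free_group_def reduced_Cons)
    have xc: "[x] \<in> carrier ?F"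
      using a x by (simp add: free_group_def reduced_Cons)
    have "h [x] = (if b then f a else inv f a)"
    proof (cases b)
      case True
      then show ?thesis using h a x by (simp add: gen_def)
    next
      case False
      then have "[x] = inv\<^bsub>?F\<^esub> gen a"
        using inv_free_group [OF gencar [OF a]] x by (simp add: gen_def letter_inv_def)
      then show ?thesis using h a False gencar [OF a] by simp
    qed
    moreover have "h (x # w) = h [x] \<otimes> h w"
      using H.hom_mult [OF xc w] reduce_id [OF red] by (simp add: mult)
    ultimately show ?case
      using Cons.IH [OF w] x by (simp add: eval_word_Cons)
  qed
  with h show "h = ?h" by (intro extensionalityI [of _ "carrier ?F"]) auto
qed

section \<open>Visual metrics\<close>

text \<open>Elements of the free group are reduced words, so the length of the reduced word
  representing an element is simply its length as a list.\<close>

definition word_dist :: "'a set \<Rightarrow> 'a word \<Rightarrow> 'a word \<Rightarrow> real" where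
  "word_dist A g h = real (length (inv\<^bsub>free_group A\<^esub> g \<otimes>\<^bsub>free_group A\<^esub> h))"

definition gromov_product :: "'a set \<Rightarrow> 'a word \<Rightarrow> 'a word \<Rightarrow> 'a word \<Rightarrow> real" where
  "gromov_product A p g h = (word_dist A p g + word_dist A p h - word_dist A g h) / 2"

definition visual_rho :: "'a set \<Rightarrow> 'a word \<Rightarrow> real \<Rightarrow> 'a word \<Rightarrow> 'a word \<Rightarrow> real" where
  "visual_rho A p \<gamma> g h = (if g \<noteq> h then exp (- \<gamma> * gromov_product A p g h) else 0)"

text \<open>\<^locale>\<open>Metric_space\<close> also asks for nonnegativity and symmetry of \<open>d\<close> off the carrier.
  This is harmless: a metric on the carrier can be extended by 0.\<close>

definition visual_metrics ::
  "'a set \<Rightarrow> 'a word \<Rightarrow> real \<Rightarrow> real \<Rightarrow> ('a word \<Rightarrow> 'a word \<Rightarrow> real) set" where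
  "visual_metrics A p \<gamma> T =
    {d. Metric_space (carrier (free_group A)) d \<and>
        (\<forall>g\<in>carrier (free_group A). \<forall>h\<in>carrier (free_group A). g \<noteq> h \<longrightarrow>
           1 / T * visual_rho A p \<gamma> g h \<le> d g h \<and> d g h \<le> T * visual_rho A p \<gamma> g h)}"

definition lipschitz_condition :: "'b set \<Rightarrow> ('b \<Rightarrow> 'b \<Rightarrow> real) \<Rightarrow> ('b \<Rightarrow> 'b) \<Rightarrow> bool" where
  "lipschitz_condition M d \<phi> \<longleftrightarrow>
    (\<exists>K>0. \<forall>g\<in>M. \<forall>h\<in>M. d (\<phi> g) (\<phi> h) \<le> K * d g h)"

lemma lipschitz_condition_iff_library:
  assumes "Metric_space M d" and "\<phi> \<in> M \<rightarrow> M"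
  shows "lipschitz_condition M d \<phi> \<longleftrightarrow>
    Lipschitz_continuous_map (metric (M, d)) (metric (M, d)) \<phi>"
  using assms
  by (auto simp: lipschitz_condition_def Lipschitz_continuous_map_pos
      Metric_space.mspace_metric Metric_space.mdist_metric)

section \<open>Automorphisms, written on the right\<close>

text \<open>\<^const>\<open>AutoGroup\<close> multiplies by \<open>g \<otimes> f = g \<circ> f\<close>. Since maps are written on the right, the
  product \<open>\<phi>\<psi>\<close> means first \<open>\<phi>\<close>, then \<open>\<psi>\<close>, which is the opposite group.\<close>

definition right_AutoGroup :: "('b, 'c) monoid_scheme \<Rightarrow> ('b \<Rightarrow> 'b) monoid" where
  "right_AutoGroup G = (AutoGroup G)\<lparr>mult := (\<lambda>\<phi> \<psi>. \<psi> \<otimes>\<^bsub>AutoGroup G\<^esub> \<phi>)\<rparr>"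

lemma (in group) group_right_AutoGroup: "group (right_AutoGroup G)"
proof -
  interpret A: group "AutoGroup G" by (rule AutoGroup)
  show ?thesis
    by (rule groupI)
      (auto simp: right_AutoGroup_def A.m_assoc intro: A.r_inv A.inv_closed)
qed

lemma right_AutoGroup_mult:
  assumes "\<phi> \<in> auto G" "\<psi> \<in> auto G" "x \<in> carrier G"
  shows "(\<phi> \<otimes>\<^bsub>right_AutoGroup G\<^esub> \<psi>) x = \<psi> (\<phi> x)"
  using assms by (simp add: right_AutoGroup_def AutoGroup_def BijGroup_def auto_def compose_def)

definition Inn :: "('b, 'c) monoid_scheme \<Rightarrow> ('b \<Rightarrow> 'b) set" where
  "Inn G = {(\<lambda>g\<in>carrier G. inv\<^bsub>G\<^esub> x \<otimes>\<^bsub>G\<^esub> g \<otimes>\<^bsub>G\<^esub> x) | x. x \<in> carrier G}"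

definition Per :: "'a set \<Rightarrow> ('a word \<Rightarrow> 'a word) set" where
  "Per A = {\<phi> \<in> auto (free_group A). bij_betw \<phi> (sym_gens A) (sym_gens A)}"

end

theory Submission
  imports Defs "HOL-Algebra.Zassenhaus"
begin

text \<open>Since the Gromov product at the identity of \<open>g\<close> and a word extending it is the length
  \<open>|g|\<close>, a Lipschitz automorphism \<open>\<phi>\<close> satisfies \<open>|g\<phi>| \<ge> |g| - C\<close>, so \<open>\<psi> = \<phi>\<^sup>-\<^sup>1\<close> satisfies
  \<open>|g\<psi>| \<le> |g| + C\<close>. Applying this to powers, \<open>\<psi>\<close> cannot increase the cyclically reduced length
  of a generator or of a product of two generators. Hence every \<open>a\<psi>\<close> is a conjugate of a letter,
  and the axes of these conjugates in the Cayley tree meet pairwise, so they all meet in one vertex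
  \<open>v\<close>: the conjugate of \<open>\<psi>\<close> by \<open>v\<close> maps generators to letters and is a permutation automorphism.
  The vertex is found as a minimiser of the total length \<open>\<Sum>a\<in>A. |v\<^sup>-\<^sup>1 (a\<psi>) v|\<close>.
  Conversely, permutation automorphisms preserve word length and inner automorphisms change it by a
  bounded amount, so their products change Gromov products by a bounded amount.\<close>

section \<open>Reduced words and cyclic reduction\<close>

interpretation F: group "free_group A" for A :: "'a set"
  by (rule group_free_group)

abbreviation word_inv :: "'a word \<Rightarrow> 'a word" where
  "word_inv w \<equiv> rev (map letter_inv w)"

lemma letter_inv_neq [simp]: "letter_inv x \<noteq> x" "x \<noteq> letter_inv x"
  by (auto simp: letter_inv_def prod_eq_iff)

lemma reduced_append_iff:
  "reduced_word (u @ v) \<longleftrightarrow>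
    reduced_word u \<and> reduced_word v \<and> (u = [] \<or> v = [] \<or> hd v \<noteq> letter_inv (last u))"
  by (auto simp: reduced_word_def successively_append_iff)

lemma free_group_mult: "u \<otimes>\<^bsub>free_group A\<^esub> v = reduce (u @ v)"
  by (simp add: free_group_def)

lemma free_group_one: "\<one>\<^bsub>free_group A\<^esub> = []"
  by (simp add: free_group_def)

lemma free_group_carrier_iff:
  "w \<in> carrier (free_group A) \<longleftrightarrow> reduced_word w \<and> set w \<subseteq> A \<times> UNIV"
  by (simp add: free_group_def)

lemma letter_in_free_group: "fst x \<in> A \<Longrightarrow> [x] \<in> carrier (free_group A)"
  by (cases x) (simp add: free_group_carrier_iff reduced_Cons)

lemma gen_in_free_group: "a \<in> A \<Longrightarrow> gen a \<in> carrier (free_group A)"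
  by (simp add: gen_def letter_in_free_group)

lemma length_gen [simp]: "length (gen a) = 1"
  by (simp add: gen_def)

section \<open>Word length of products, inverses, powers and conjugates\<close>

lemma length_cons_red: "length (cons_red x w) \<le> Suc (length w)"
  by (cases w) auto

lemma length_reduce: "length (reduce w) \<le> length w"
  unfolding reduce_def
proof (induction w)
  case (Cons x w)
  then show ?case using length_cons_red [of x "foldr cons_red w []"] by simp
qed simp

lemma length_mult: "length (u \<otimes>\<^bsub>free_group A\<^esub> v) \<le> length u + length v"
  using length_reduce [of "u @ v"] by (simp add: free_group_mult)

lemma length_inv:
  "w \<in> carrier (free_group A) \<Longrightarrow> length (inv\<^bsub>free_group A\<^esub> w) = length w"
  by (simp add: inv_free_group)

lemma length_pow: "length (w [^]\<^bsub>free_group A\<^esub> (n::nat)) \<le> n * length w"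
proof (induction n)
  case (Suc n)
  then show ?case
    using length_mult [of A "w [^]\<^bsub>free_group A\<^esub> n" w] by simp
qed (simp add: free_group_one)

lemma length_conj:
  assumes "v \<in> carrier (free_group A)"
  shows "length (inv\<^bsub>free_group A\<^esub> v \<otimes>\<^bsub>free_group A\<^esub> g \<otimes>\<^bsub>free_group A\<^esub> v) \<le> length g + 2 * length v"
  using length_mult [of A "inv\<^bsub>free_group A\<^esub> v \<otimes>\<^bsub>free_group A\<^esub> g" v]
    length_mult [of A "inv\<^bsub>free_group A\<^esub> v" g] length_inv [OF assms]
  by linarith

lemma (in group) inner_mult:
  assumes "x \<in> carrier G" "g \<in> carrier G" "h \<in> carrier G"
  shows "inv x \<otimes> (g \<otimes> h) \<otimes> x = (inv x \<otimes> g \<otimes> x) \<otimes> (inv x \<otimes> h \<otimes> x)"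
proof -
  have "x \<otimes> (inv x \<otimes> (h \<otimes> x)) = h \<otimes> x"
    using assms by (simp add: m_assoc [symmetric])
  then show ?thesis using assms by (simp add: m_assoc)
qed

lemma (in group) inner_pow:
  assumes "x \<in> carrier G" "g \<in> carrier G"
  shows "(inv x \<otimes> g \<otimes> x) [^] (n::nat) = inv x \<otimes> g [^] n \<otimes> x"
  using assms by (induction n) (simp_all add: inner_mult)

text \<open>The condition on the ends says that nothing cancels where one copy of \<open>u\<close>
  follows another; the empty word, on which \<open>hd\<close> and \<open>last\<close> are
  unspecified, is excluded.\<close>

definition cyc_reduced :: "'a word \<Rightarrow> bool" where
  "cyc_reduced u \<longleftrightarrow> u \<noteq> [] \<and> reduced_word u \<and> hd u \<noteq> letter_inv (last u)"

text \<open>Both claims go through one induction: the next power is a plain concatenation because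
  that concatenation is already reduced.\<close>

lemma cyc_reduced_pow:
  assumes "cyc_reduced u"
  shows "u [^]\<^bsub>free_group A\<^esub> n = concat (replicate n u) \<and> reduced_word (concat (replicate n u))"
proof (induction n)
  case (Suc n)
  \<comment> \<open>Group powers multiply on the right, so the extra copy of \<open>u\<close> is
    split off at the end.\<close>
  have rep: "concat (replicate (Suc m) u) = concat (replicate m u) @ u" for m
    by (induction m) auto
  have "reduced_word (concat (replicate n u) @ u)"
  proof (cases n)
    case (Suc m)
    with \<open>_ \<and> _\<close> assms show ?thesis
      by (simp only: rep reduced_append_iff cyc_reduced_def) (simp add: cyc_reduced_def)
  qed (use assms in \<open>simp add: cyc_reduced_def\<close>)
  with Suc show ?case
    by (simp only: rep) (simp add: free_group_mult reduce_id)
qed (simp add: free_group_one)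

lemma length_cyc_reduced_pow:
  assumes "cyc_reduced u"
  shows "length (u [^]\<^bsub>free_group A\<^esub> n) = n * length u"
  using cyc_reduced_pow [OF assms] by (simp add: length_concat sum_list_replicate)

text \<open>The length of the powers of \<open>u\<close> grows linearly with slope exactly
  \<open>length u\<close>, so an additive constant cannot make up for a slope above
  \<open>k\<close>.\<close>

lemma cyc_reduced_length_le:
  assumes "cyc_reduced u" and "\<And>n. length (u [^]\<^bsub>free_group A\<^esub> (n::nat)) \<le> n * k + C"
  shows "length u \<le> k"
proof (rule ccontr)
  assume "\<not> length u \<le> k"
  \<comment> \<open>With exponent \<open>Suc C\<close> the excess over slope \<open>k\<close> is at
    least \<open>Suc C\<close>, just more than the constant allows.\<close>
  then have "Suc C * Suc k \<le> Suc C * length u" by (intro mult_le_mono2) simp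
  also have "\<dots> \<le> Suc C * k + C"
    using assms(2) [of "Suc C"] length_cyc_reduced_pow [OF assms(1), of A "Suc C"] by simp
  finally show False by simp
qed

text \<open>Mutually inverse outer letters are peeled off pair by pair. The equation is one of
  words, not only of group elements, so nothing cancels between the three factors.\<close>

lemma cyclic_reduction:
  assumes "reduced_word g" "g \<noteq> []"
  shows "\<exists>w c. g = w @ c @ word_inv w \<and> cyc_reduced c"
  using assms
proof (induction "length g" arbitrary: g rule: less_induct)
  case less
  show ?case
  proof (cases "hd g = letter_inv (last g)")
    case False
    with less show ?thesis
      by (intro exI [of _ "[]"] exI [of _ g]) (simp add: cyc_reduced_def)
  next
    case True
    obtain x r where g: "g = x # r" using less.prems by (cases g) auto
    with True have "r \<noteq> []" by auto
    then obtain m where r: "r = m @ [last r]" by (metis append_butlast_last_id)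
    with True g have g': "g = x # m @ [letter_inv x]"
      using \<open>r \<noteq> []\<close> by (simp add: letter_inv_eq_iff [symmetric])
    \<comment> \<open>The middle is nonempty, since otherwise \<open>x\<close> would be followed by
      its inverse in the reduced word \<open>g\<close>.\<close>
    with less.prems have m: "reduced_word m" "m \<noteq> []"
      by (auto simp: reduced_Cons reduced_append_iff)
    obtain w c where "m = w @ c @ word_inv w" "cyc_reduced c"
      using less.hyps [of m] m g' by auto
    then show ?thesis
      by (intro exI [of _ "x # w"] exI [of _ c]) (simp add: g')
  qed
qed

section \<open>Shortening a basis by conjugation\<close>

text \<open>If \<open>w\<close> is nonempty, either alternative for \<open>y\<close> makes
  \<open>y\<close> the first letter of \<open>w\<close>, and the conjugation strips the outer pair
  of letters of \<open>g\<close>. If \<open>w\<close> is empty, \<open>g\<close> is \<open>y\<close>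
  or its inverse and commutes with \<open>y\<close>.\<close>

lemma conj_letter_le:
  assumes g: "g = w @ [x] @ word_inv w" "g \<in> carrier (free_group A)"
    and y: "hd g = y \<or> last g = letter_inv y"
  shows "length ([letter_inv y] \<otimes>\<^bsub>free_group A\<^esub> g \<otimes>\<^bsub>free_group A\<^esub> [y]) \<le> length g"
    and "w \<noteq> [] \<Longrightarrow>
      length ([letter_inv y] \<otimes>\<^bsub>free_group A\<^esub> g \<otimes>\<^bsub>free_group A\<^esub> [y]) < length g"
proof -
  let ?c = "[letter_inv y] \<otimes>\<^bsub>free_group A\<^esub> g \<otimes>\<^bsub>free_group A\<^esub> [y]"
  have red: "reduced_word g" using g by (simp add: free_group_carrier_iff)
  have less: "length ?c < length g" if "w \<noteq> []"
  proof -
    obtain z v where w: "w = z # v" using \<open>w \<noteq> []\<close> by (cases w) auto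
    have "z = y" using y g(1) w by (auto simp: letter_inv_eq_iff)
    let ?m = "v @ [x] @ word_inv v"
    have gm: "g = [y] @ ?m @ [letter_inv y]" using g(1) w \<open>z = y\<close> by simp
    with red have m: "reduced_word (?m @ [letter_inv y])"
      by (simp add: reduced_Cons)
    have "reduce ([letter_inv y] @ g) = ?m @ [letter_inv y]"
      using cons_red_cancel [OF m, of "letter_inv y"] reduce_id [OF m]
      by (simp add: gm reduce_def)
    then have "?c = reduce (?m @ reduce ([letter_inv y] @ [y]))"
      using reduce_append_right [of ?m "[letter_inv y] @ [y]"] by (simp add: free_group_mult)
    also have "\<dots> = reduce ?m"
      by (simp add: reduce_def)
    finally show ?thesis using length_reduce [of ?m] gm by simp
  qed
  then show "w \<noteq> [] \<Longrightarrow> length ?c < length g" .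
  show "length ?c \<le> length g"
  proof (cases "w = []")
    case True
    with g y have "g = [y] \<or> g = [letter_inv y]" by auto
    then show ?thesis by (auto simp: free_group_mult reduce_def)
  qed (use less in simp)
qed

text \<open>A conjugation by the first letter \<open>y\<close> of a nontrivial conjugator shortens every
  other element or leaves its length unchanged; otherwise some product of two elements would be
  cyclically reduced of length greater than 2.\<close>

lemma conj_minimal_letters:
  fixes \<theta> :: "'i \<Rightarrow> 'a word"
  assumes "finite I" and car: "\<And>i. i \<in> I \<Longrightarrow> \<theta> i \<in> carrier (free_group A)"
    and ne: "\<And>i. i \<in> I \<Longrightarrow> \<theta> i \<noteq> []"
    and bound1: "\<And>i n. i \<in> I \<Longrightarrow> length (\<theta> i [^]\<^bsub>free_group A\<^esub> (n::nat)) \<le> n + C"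
    and bound2: "\<And>i j n. i \<in> I \<Longrightarrow> j \<in> I \<Longrightarrow>
      length ((\<theta> i \<otimes>\<^bsub>free_group A\<^esub> \<theta> j) [^]\<^bsub>free_group A\<^esub> (n::nat)) \<le> n * 2 + C"
    and min: "\<And>v. v \<in> carrier (free_group A) \<Longrightarrow> (\<Sum>i\<in>I. length (\<theta> i)) \<le>
      (\<Sum>i\<in>I. length (inv\<^bsub>free_group A\<^esub> v \<otimes>\<^bsub>free_group A\<^esub> \<theta> i \<otimes>\<^bsub>free_group A\<^esub> v))"
    and "i \<in> I"
  shows "length (\<theta> i) = 1"
proof -
  have form: "\<exists>w x. \<theta> j = w @ [x] @ word_inv w" if j: "j \<in> I" for j
  proof -
    obtain w c where wc: "\<theta> j = w @ c @ word_inv w" "cyc_reduced c"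
      using cyclic_reduction [of "\<theta> j"] ne car j by (auto simp: free_group_carrier_iff)
    have w: "w \<in> carrier (free_group A)" and c: "c \<in> carrier (free_group A)"
      using car [OF j] wc by (auto simp: free_group_carrier_iff reduced_append_iff)
    have "\<theta> j = w \<otimes>\<^bsub>free_group A\<^esub> c \<otimes>\<^bsub>free_group A\<^esub> inv\<^bsub>free_group A\<^esub> w"
      using car [OF j] wc
      by (simp add: free_group_mult inv_free_group [OF w] reduce_append_left reduce_id
          free_group_carrier_iff)
    then have "c = inv\<^bsub>free_group A\<^esub> w \<otimes>\<^bsub>free_group A\<^esub> \<theta> j \<otimes>\<^bsub>free_group A\<^esub> w"
      using w c by (simp add: F.m_assoc) (simp add: F.m_assoc [symmetric])
    \<comment> \<open>Conjugation by \<open>w\<close> adds at most \<open>2 * length w\<close>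
      whatever the exponent, so the powers of \<open>c\<close> also grow at rate at most 1.\<close>
    then have "length (c [^]\<^bsub>free_group A\<^esub> n) \<le> n * 1 + (C + 2 * length w)" for n :: nat
      using bound1 [OF j, of n] length_conj [OF w, of "\<theta> j [^]\<^bsub>free_group A\<^esub> n"]
        F.inner_pow [OF w car [OF j], of n] by simp
    then have "length c \<le> 1" by (rule cyc_reduced_length_le [OF wc(2)])
    with wc show ?thesis by (cases c) (auto simp: cyc_reduced_def)
  qed
  obtain w x where wx: "\<theta> i = w @ [x] @ word_inv w" using form \<open>i \<in> I\<close> by blast
  have "w = []"
  proof (rule ccontr)
    assume "w \<noteq> []"
    define y where "y = hd w"
    have hl: "hd (\<theta> i) = y" "last (\<theta> i) = letter_inv y"
      using \<open>w \<noteq> []\<close> by (auto simp: wx y_def last_rev hd_map hd_append)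
    have y: "[y] \<in> carrier (free_group A)"
      using car [OF \<open>i \<in> I\<close>] \<open>w \<noteq> []\<close> hd_in_set [of w]
      by (auto simp: wx y_def free_group_carrier_iff reduced_Cons)
    have invy: "inv\<^bsub>free_group A\<^esub> [y] = [letter_inv y]"
      using inv_free_group [OF y] by simp
    \<comment> \<open>Were both alternatives false, neither junction of
      \<open>\<theta> i @ \<theta> j\<close> with itself would cancel. This word has length at least
      3 + 1, as \<open>w\<close> is nonempty, but its powers grow at rate at most 2.\<close>
    have ends: "hd (\<theta> j) = y \<or> last (\<theta> j) = letter_inv y" if j: "j \<in> I" for j
    proof (rule ccontr)
      assume "\<not> ?thesis"
      then have "hd (\<theta> j) \<noteq> letter_inv (last (\<theta> i))" "hd (\<theta> i) \<noteq> letter_inv (last (\<theta> j))"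
        using hl letter_inv_eq_iff [of "last (\<theta> j)" y] by auto
      moreover have "reduced_word (\<theta> i)" "reduced_word (\<theta> j)"
        using car \<open>i \<in> I\<close> j by (simp_all add: free_group_carrier_iff)
      ultimately have cyc: "cyc_reduced (\<theta> i @ \<theta> j)"
        using ne [OF j] ne [OF \<open>i \<in> I\<close>] by (simp add: cyc_reduced_def reduced_append_iff)
      then have "\<theta> i \<otimes>\<^bsub>free_group A\<^esub> \<theta> j = \<theta> i @ \<theta> j"
        by (simp add: free_group_mult reduce_id cyc_reduced_def)
      then have "length ((\<theta> i @ \<theta> j) [^]\<^bsub>free_group A\<^esub> n) \<le> n * 2 + C" for n :: nat
        using bound2 [OF \<open>i \<in> I\<close> j, of n] by simp
      then have "length (\<theta> i @ \<theta> j) \<le> 2" by (rule cyc_reduced_length_le [OF cyc])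
      then show False using \<open>w \<noteq> []\<close> ne [OF j] by (cases w; cases "\<theta> j") (auto simp: wx)
    qed
    \<comment> \<open>Conjugation by \<open>y\<close> lengthens no summand and shortens the one at
      \<open>i\<close>, against minimality.\<close>
    have "(\<Sum>j\<in>I. length (inv\<^bsub>free_group A\<^esub> [y] \<otimes>\<^bsub>free_group A\<^esub> \<theta> j \<otimes>\<^bsub>free_group A\<^esub> [y]))
        < (\<Sum>j\<in>I. length (\<theta> j))"
      unfolding invy
    proof (rule sum_strict_mono_ex1 [OF \<open>finite I\<close>])
      show "\<forall>j\<in>I. length ([letter_inv y] \<otimes>\<^bsub>free_group A\<^esub> \<theta> j \<otimes>\<^bsub>free_group A\<^esub> [y]) \<le> length (\<theta> j)"
      proof
        fix j assume j: "j \<in> I"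
        then obtain v z where "\<theta> j = v @ [z] @ word_inv v" using form by blast
        then show "length ([letter_inv y] \<otimes>\<^bsub>free_group A\<^esub> \<theta> j \<otimes>\<^bsub>free_group A\<^esub> [y]) \<le> length (\<theta> j)"
          using car [OF j] ends [OF j] by (rule conj_letter_le(1))
      qed
      show "\<exists>j\<in>I. length ([letter_inv y] \<otimes>\<^bsub>free_group A\<^esub> \<theta> j \<otimes>\<^bsub>free_group A\<^esub> [y]) < length (\<theta> j)"
        using conj_letter_le(2) [OF wx car [OF \<open>i \<in> I\<close>] ends [OF \<open>i \<in> I\<close>] \<open>w \<noteq> []\<close>] \<open>i \<in> I\<close>
        by (rule bexI)
    qed
    with min [OF y] show False by simp
  qed
  then show ?thesis by (simp add: wx)
qed

section \<open>Inner and permutation automorphisms\<close>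

lemma right_AutoGroup_carrier [simp]: "carrier (right_AutoGroup G) = auto G"
  by (simp add: right_AutoGroup_def AutoGroup_def)

lemma right_AutoGroup_one: "\<one>\<^bsub>right_AutoGroup G\<^esub> = (\<lambda>x\<in>carrier G. x)"
  by (simp add: right_AutoGroup_def AutoGroup_def BijGroup_def)

text \<open>Elements of \<open>auto G\<close> are extensional, so their values off the carrier are
  fixed.\<close>

lemma auto_eqI:
  assumes "\<phi> \<in> auto G" "\<psi> \<in> auto G" "\<And>x. x \<in> carrier G \<Longrightarrow> \<phi> x = \<psi> x"
  shows "\<phi> = \<psi>"
  using assms by (intro extensionalityI [of _ "carrier G"]) (auto simp: auto_def Bij_def)

lemma auto_closed: "\<phi> \<in> auto G \<Longrightarrow> x \<in> carrier G \<Longrightarrow> \<phi> x \<in> carrier G"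
  by (auto simp: auto_def hom_def)

lemma auto_inj: "\<phi> \<in> auto G \<Longrightarrow> inj_on \<phi> (carrier G)"
  by (auto simp: auto_def Bij_def bij_betw_def)

lemma (in group) auto_hom: "\<phi> \<in> auto G \<Longrightarrow> group_hom G G \<phi>"
  by unfold_locales (simp add: auto_def)

lemma (in group) auto_inv_m [simp]:
  assumes "\<phi> \<in> auto G"
  shows "inv\<^bsub>right_AutoGroup G\<^esub> \<phi> \<in> auto G"
  using group.inv_closed [OF group_right_AutoGroup] assms by simp

lemma (in group) auto_inv_apply:
  assumes "\<phi> \<in> auto G" "x \<in> carrier G"
  shows "\<phi> ((inv\<^bsub>right_AutoGroup G\<^esub> \<phi>) x) = x" "(inv\<^bsub>right_AutoGroup G\<^esub> \<phi>) (\<phi> x) = x"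
  using group.l_inv [OF group_right_AutoGroup, of \<phi>] group.r_inv [OF group_right_AutoGroup, of \<phi>]
    right_AutoGroup_mult [OF auto_inv_m [OF assms(1)] assms]
    right_AutoGroup_mult [OF assms(1) auto_inv_m [OF assms(1)] assms(2)] assms
  by (simp_all add: right_AutoGroup_one)

text \<open>With the inverse on the left, \<open>inner G\<close> is a homomorphism into
  \<open>right_AutoGroup G\<close>, where the left factor acts first; see
  \<open>inner_compose\<close>.\<close>

definition inner :: "('b, 'c) monoid_scheme \<Rightarrow> 'b \<Rightarrow> 'b \<Rightarrow> 'b" where
  "inner G x = (\<lambda>g\<in>carrier G. inv\<^bsub>G\<^esub> x \<otimes>\<^bsub>G\<^esub> g \<otimes>\<^bsub>G\<^esub> x)"

lemma Inn_eq: "Inn G = inner G ` carrier G"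
  by (auto simp: Inn_def inner_def)

section \<open>Normality of the inner automorphisms in an arbitrary group\<close>

context group
begin

lemma inner_inner:
  assumes "x \<in> carrier G" "y \<in> carrier G" "g \<in> carrier G"
  shows "inner G y (inner G x g) = inner G (x \<otimes> y) g"
  using assms by (simp add: inner_def inv_mult_group m_assoc)

lemma inner_one: "g \<in> carrier G \<Longrightarrow> inner G \<one> g = g"
  by (simp add: inner_def)

lemma inner_auto:
  assumes "x \<in> carrier G"
  shows "inner G x \<in> auto G"
proof -
  have "inner G x \<in> hom G G"
    using assms by (auto simp: hom_def inner_def inner_mult)
  moreover have "bij_betw (inner G x) (carrier G) (carrier G)"
  proof (rule bij_betwI)
    show "inner G x \<in> carrier G \<rightarrow> carrier G" "inner G (inv x) \<in> carrier G \<rightarrow> carrier G"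
      using assms by (auto simp: inner_def)
  qed (use assms in \<open>simp_all add: inner_inner inner_one\<close>)
  ultimately show ?thesis by (simp add: auto_def Bij_def inner_def)
qed

lemma inner_in_Inn: "x \<in> carrier G \<Longrightarrow> inner G x \<in> Inn G"
  by (simp add: Inn_eq)

lemma inner_compose:
  assumes "x \<in> carrier G" "y \<in> carrier G"
  shows "inner G x \<otimes>\<^bsub>right_AutoGroup G\<^esub> inner G y = inner G (x \<otimes> y)"
proof (rule auto_eqI)
  show "inner G x \<otimes>\<^bsub>right_AutoGroup G\<^esub> inner G y \<in> auto G"
    using monoid.m_closed [OF group.is_monoid [OF group_right_AutoGroup]] inner_auto assms by simp
qed (use assms in \<open>simp_all add: inner_auto right_AutoGroup_mult inner_inner\<close>)

lemma inner_one_eq: "inner G \<one> = \<one>\<^bsub>right_AutoGroup G\<^esub>"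
  by (auto simp: right_AutoGroup_one inner_def fun_eq_iff)

lemma inv_inner:
  assumes "x \<in> carrier G"
  shows "inv\<^bsub>right_AutoGroup G\<^esub> inner G x = inner G (inv x)"
  using assms inner_compose [of "inv x" x]
  by (intro group.inv_equality [OF group_right_AutoGroup]) (simp_all add: inner_auto inner_one_eq)

lemma Inn_normal: "Inn G \<lhd> right_AutoGroup G"
proof -
  interpret R: group "right_AutoGroup G" by (rule group_right_AutoGroup)
  have "subgroup (Inn G) (right_AutoGroup G)"
  proof (rule R.subgroupI)
    show "Inn G \<noteq> {}" by (auto simp: Inn_eq)
  qed (auto simp: Inn_eq inner_auto inv_inner inner_compose)
  moreover have "\<phi> \<otimes>\<^bsub>right_AutoGroup G\<^esub> \<iota> \<otimes>\<^bsub>right_AutoGroup G\<^esub> inv\<^bsub>right_AutoGroup G\<^esub> \<phi> \<in> Inn G"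
    if \<phi>: "\<phi> \<in> auto G" and "\<iota> \<in> Inn G" for \<phi> \<iota>
  proof -
    let ?\<psi> = "inv\<^bsub>right_AutoGroup G\<^esub> \<phi>"
    obtain x where x: "x \<in> carrier G" and \<iota>: "\<iota> = inner G x" using \<open>\<iota> \<in> Inn G\<close> by (auto simp: Inn_eq)
    have \<psi>: "?\<psi> \<in> auto G" using \<phi> by simp
    interpret P: group_hom G G ?\<psi> by (rule auto_hom [OF \<psi>])
    have m: "\<phi> \<otimes>\<^bsub>right_AutoGroup G\<^esub> inner G x \<in> auto G"
      using \<phi> x R.m_closed inner_auto by simp
    \<comment> \<open>The homomorphism \<open>?\<psi>\<close>, applied last, undoes \<phi> on the
      conjugated element and replaces the conjugator \<open>x\<close> by its image.\<close>
    have "\<phi> \<otimes>\<^bsub>right_AutoGroup G\<^esub> inner G x \<otimes>\<^bsub>right_AutoGroup G\<^esub> ?\<psi> = inner G (?\<psi> x)"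
    proof (rule auto_eqI)
      show "\<phi> \<otimes>\<^bsub>right_AutoGroup G\<^esub> inner G x \<otimes>\<^bsub>right_AutoGroup G\<^esub> ?\<psi> \<in> auto G"
        using R.m_closed m \<psi> by simp
      show "inner G (?\<psi> x) \<in> auto G" using inner_auto x by simp
      fix g assume g: "g \<in> carrier G"
      have "\<phi> g \<in> carrier G" by (rule auto_closed [OF \<phi> g])
      then show "(\<phi> \<otimes>\<^bsub>right_AutoGroup G\<^esub> inner G x \<otimes>\<^bsub>right_AutoGroup G\<^esub> ?\<psi>) g = inner G (?\<psi> x) g"
        using \<phi> \<psi> m g x by (simp add: right_AutoGroup_mult inner_auto auto_inv_apply)
          (simp add: inner_def auto_inv_apply)
    qed
    then show ?thesis using \<iota> x by (simp add: inner_in_Inn)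
  qed
  ultimately show ?thesis by (auto simp: R.normal_inv_iff)
qed

end

section \<open>The subgroup of permutation automorphisms and its product with the inner ones\<close>

lemma sym_gens_iff: "w \<in> sym_gens A \<longleftrightarrow> w \<in> carrier (free_group A) \<and> length w = 1"
  by (auto simp: sym_gens_eq free_group_carrier_iff reduced_Cons length_Suc_conv)

lemma Per_subgroup: "subgroup (Per A) (right_AutoGroup (free_group A))"
proof -
  let ?R = "right_AutoGroup (free_group A)"
  interpret R: group ?R by (rule F.group_right_AutoGroup)
  have S: "x \<in> carrier (free_group A)" if "x \<in> sym_gens A" for x
    using that by (simp add: sym_gens_iff)
  show ?thesis
  proof (rule R.subgroupI)
    show "Per A \<subseteq> carrier ?R" by (auto simp: Per_def)
    have "\<one>\<^bsub>?R\<^esub> \<in> Per A"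
      using R.one_closed S by (auto simp: Per_def right_AutoGroup_one bij_betw_def inj_on_def image_iff)
    then show "Per A \<noteq> {}" by blast
  next
    fix \<phi> assume "\<phi> \<in> Per A"
    then have \<phi>: "\<phi> \<in> auto (free_group A)" and b: "bij_betw \<phi> (sym_gens A) (sym_gens A)"
      by (auto simp: Per_def)
    have "(inv\<^bsub>?R\<^esub> \<phi>) y \<in> sym_gens A" if "y \<in> sym_gens A" for y
    proof -
      obtain x where "x \<in> sym_gens A" "y = \<phi> x" using b \<open>y \<in> sym_gens A\<close> by (auto simp: bij_betw_def)
      then show ?thesis using F.auto_inv_apply(2) [OF \<phi> S] by simp
    qed
    moreover have "\<phi> x \<in> sym_gens A" if "x \<in> sym_gens A" for x
      using b that by (auto simp: bij_betw_def)
    ultimately have "bij_betw (inv\<^bsub>?R\<^esub> \<phi>) (sym_gens A) (sym_gens A)"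
      using F.auto_inv_apply [OF \<phi> S] by (intro bij_betwI [of _ _ _ \<phi>]) auto
    then show "inv\<^bsub>?R\<^esub> \<phi> \<in> Per A" using \<phi> by (simp add: Per_def)
  next
    fix \<phi> \<psi> assume "\<phi> \<in> Per A" "\<psi> \<in> Per A"
    then have \<phi>: "\<phi> \<in> auto (free_group A)" "bij_betw \<phi> (sym_gens A) (sym_gens A)"
      and \<psi>: "\<psi> \<in> auto (free_group A)" "bij_betw \<psi> (sym_gens A) (sym_gens A)"
      by (auto simp: Per_def)
    have "bij_betw (\<psi> \<circ> \<phi>) (sym_gens A) (sym_gens A)"
      using bij_betw_trans [OF \<phi>(2) \<psi>(2)] .
    then have "bij_betw (\<phi> \<otimes>\<^bsub>?R\<^esub> \<psi>) (sym_gens A) (sym_gens A)"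
      by (rule bij_betw_cong [THEN iffD1, rotated])
        (simp add: right_AutoGroup_mult [OF \<phi>(1) \<psi>(1) S])
    then show "\<phi> \<otimes>\<^bsub>?R\<^esub> \<psi> \<in> Per A" using \<phi> \<psi> R.m_closed by (simp add: Per_def)
  qed
qed

text \<open>Normality makes the product of the two subgroups a subgroup. It contains both factors
  because each of them contains the unit, and its elements are products of generators.\<close>

lemma (in group) generate_normal_Un:
  assumes N: "N \<lhd> G" and H: "subgroup H G"
  shows "generate G (N \<union> H) = H <#> N"
proof
  have NH: "subgroup (H <#> N) G"
    \<comment> \<open>This fact has the normal factor on the left; \<open>commut_normal\<close>
      exchanges the factors.\<close>
    using mult_norm_subgroup [OF N H] commut_normal [OF H N] by simp
  have sub: "subgroup N G" using N by (rule normal_imp_subgroup)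
  have "N \<subseteq> H <#> N"
  proof
    fix n assume "n \<in> N"
    then show "n \<in> H <#> N"
      using subgroup.one_closed [OF H] subgroup.mem_carrier [OF sub]
      by (force simp: set_mult_def)
  qed
  moreover have "H \<subseteq> H <#> N"
  proof
    fix h assume "h \<in> H"
    then show "h \<in> H <#> N"
      using subgroup.one_closed [OF sub] subgroup.mem_carrier [OF H]
      by (force simp: set_mult_def)
  qed
  ultimately show "generate G (N \<union> H) \<subseteq> H <#> N"
    by (intro generate_subgroup_incl [OF _ NH]) simp
  show "H <#> N \<subseteq> generate G (N \<union> H)"
    by (auto simp: set_mult_def intro: generate.eng generate.incl)
qed

section \<open>Word length under permutation and inner automorphisms\<close>

lemma length_Per_le:
  assumes "\<phi> \<in> Per A" "g \<in> carrier (free_group A)"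
  shows "length (\<phi> g) \<le> length g"
proof -
  have \<phi>: "\<phi> \<in> auto (free_group A)" and b: "bij_betw \<phi> (sym_gens A) (sym_gens A)"
    using assms by (auto simp: Per_def)
  interpret P: group_hom "free_group A" "free_group A" \<phi> by (rule F.auto_hom [OF \<phi>])
  show ?thesis
    using assms(2)
  proof (induction g)
    case Nil
    show ?case using P.hom_one by (simp add: free_group_one)
  next
    case (Cons x w)
    have x: "[x] \<in> carrier (free_group A)" and w: "w \<in> carrier (free_group A)"
      and red: "reduced_word (x # w)"
      using Cons.prems by (auto simp: free_group_carrier_iff reduced_Cons)
    have "\<phi> [x] \<in> sym_gens A" using b x by (auto simp: bij_betw_def sym_gens_iff)
    then have "length (\<phi> [x]) = 1" by (simp add: sym_gens_iff)
    moreover have "\<phi> (x # w) = \<phi> [x] \<otimes>\<^bsub>free_group A\<^esub> \<phi> w"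
      using P.hom_mult [OF x w] reduce_id [OF red] by (simp add: free_group_mult)
    \<comment> \<open>Cancellation in the product of the images is not excluded here, so only an
      inequality results.\<close>
    ultimately show ?case
      using length_mult [of A "\<phi> [x]" "\<phi> w"] Cons.IH [OF w] by simp
  qed
qed

text \<open>The inverse is again a permutation automorphism and does not lengthen words
  either.\<close>

lemma length_Per:
  assumes "\<phi> \<in> Per A" "g \<in> carrier (free_group A)"
  shows "length (\<phi> g) = length g"
proof -
  let ?\<psi> = "inv\<^bsub>right_AutoGroup (free_group A)\<^esub> \<phi>"
  have \<phi>: "\<phi> \<in> auto (free_group A)" using assms by (auto simp: Per_def)
  have "?\<psi> \<in> Per A"
    using assms(1) by (rule subgroup.m_inv_closed [OF Per_subgroup])
  then show ?thesis
    using length_Per_le [OF assms] length_Per_le [of ?\<psi> A "\<phi> g"] F.auto_inv_apply(2) [OF \<phi> assms(2)]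
      auto_closed [OF \<phi> assms(2)] by simp
qed

lemma Per_Inn_length:
  assumes "\<phi> \<in> Per A <#>\<^bsub>right_AutoGroup (free_group A)\<^esub> Inn (free_group A)"
  shows "\<exists>C. \<forall>g\<in>carrier (free_group A). \<bar>real (length (\<phi> g)) - real (length g)\<bar> \<le> C"
proof -
  obtain \<theta> x where \<theta>: "\<theta> \<in> Per A" and x: "x \<in> carrier (free_group A)"
    and \<phi>: "\<phi> = \<theta> \<otimes>\<^bsub>right_AutoGroup (free_group A)\<^esub> inner (free_group A) x"
    using assms by (auto simp: set_mult_def Inn_eq)
  have \<theta>': "\<theta> \<in> auto (free_group A)" using \<theta> by (simp add: Per_def)
  have "\<bar>real (length (\<phi> g)) - real (length g)\<bar> \<le> 2 * real (length x)"
    if g: "g \<in> carrier (free_group A)" for g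
  proof -
    have c: "\<theta> g \<in> carrier (free_group A)" by (rule auto_closed [OF \<theta>' g])
    have eq: "\<phi> g = inner (free_group A) x (\<theta> g)"
      using right_AutoGroup_mult [OF \<theta>' F.inner_auto [OF x] g] by (simp add: \<phi>)
    then have eq1: "\<phi> g = inv\<^bsub>free_group A\<^esub> x \<otimes>\<^bsub>free_group A\<^esub> \<theta> g \<otimes>\<^bsub>free_group A\<^esub> x"
      using c by (simp add: inner_def)
    have ix: "inv\<^bsub>free_group A\<^esub> x \<in> carrier (free_group A)" using x by simp
    \<comment> \<open>Conjugating back by the inverse of \<open>x\<close> gives the opposite
      inequality with the same constant.\<close>
    have "\<theta> g = inner (free_group A) (inv\<^bsub>free_group A\<^esub> x) (\<phi> g)"
      using c x by (simp add: eq F.inner_inner F.inner_one)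
    moreover have "\<phi> g \<in> carrier (free_group A)"
      using eq auto_closed [OF F.inner_auto [OF x] c] by simp
    ultimately have eq2: "\<theta> g = inv\<^bsub>free_group A\<^esub> (inv\<^bsub>free_group A\<^esub> x)
        \<otimes>\<^bsub>free_group A\<^esub> \<phi> g \<otimes>\<^bsub>free_group A\<^esub> inv\<^bsub>free_group A\<^esub> x"
      by (simp add: inner_def)
    show ?thesis
      using length_conj [OF x, of "\<theta> g"] length_conj [OF ix, of "\<phi> g"] length_Per [OF \<theta> g]
        length_inv [OF x] by (simp add: eq1 [symmetric] eq2 [symmetric])
  qed
  then show ?thesis by blast
qed

text \<open>A lower bound for the lengths of images under \<phi> is an upper bound for its inverse,
  and upper bounds on powers control the growth rates needed in
  \<open>conj_minimal_letters\<close>.\<close>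

lemma Per_Inn_if_length_ge:
  assumes "finite A" and \<phi>: "\<phi> \<in> auto (free_group A)"
    and ge: "\<And>g. g \<in> carrier (free_group A) \<Longrightarrow> length g \<le> length (\<phi> g) + C"
  shows "\<phi> \<in> Per A <#>\<^bsub>right_AutoGroup (free_group A)\<^esub> Inn (free_group A)"
proof -
  let ?R = "right_AutoGroup (free_group A)"
  interpret R: group ?R by (rule F.group_right_AutoGroup)
  define \<psi> where "\<psi> = inv\<^bsub>?R\<^esub> \<phi>"
  have \<psi>: "\<psi> \<in> auto (free_group A)" using \<phi> by (simp add: \<psi>_def)
  \<comment> \<open>Total lengths are natural numbers, so a minimising conjugator exists even though
    the carrier may be infinite.\<close>
  obtain v where v: "v \<in> carrier (free_group A)" and
    vmin: "\<And>u. u \<in> carrier (free_group A) \<Longrightarrow>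
      (\<Sum>a\<in>A. length (inner (free_group A) v (\<psi> (gen a)))) \<le>
      (\<Sum>a\<in>A. length (inner (free_group A) u (\<psi> (gen a))))"
    using ex_has_least_nat [of "\<lambda>v. v \<in> carrier (free_group A)" _
        "\<lambda>u. \<Sum>a\<in>A. length (inner (free_group A) u (\<psi> (gen a)))"] F.one_closed by metis
  define \<theta> where "\<theta> = \<psi> \<otimes>\<^bsub>?R\<^esub> inner (free_group A) v"
  have iv: "inner (free_group A) v \<in> auto (free_group A)" by (rule F.inner_auto [OF v])
  have \<theta>: "\<theta> \<in> auto (free_group A)"
    unfolding \<theta>_def using R.m_closed \<psi> iv by simp
  have \<theta>_apply: "\<theta> g = inner (free_group A) v (\<psi> g)" if "g \<in> carrier (free_group A)" for g
    using right_AutoGroup_mult [OF \<psi> iv that] by (simp add: \<theta>_def)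
  interpret T: group_hom "free_group A" "free_group A" \<theta> by (rule F.auto_hom [OF \<theta>])
  have len: "length (\<theta> g) \<le> length g + (C + 2 * length v)" if g: "g \<in> carrier (free_group A)" for g
  proof -
    have c: "\<psi> g \<in> carrier (free_group A)" by (rule auto_closed [OF \<psi> g])
    then have "length (\<psi> g) \<le> length g + C"
      using ge [OF c] F.auto_inv_apply(1) [OF \<phi> g] by (simp add: \<psi>_def)
    then show ?thesis
      using length_conj [OF v, of "\<psi> g"] c by (simp add: \<theta>_apply [OF g] inner_def)
  qed
  \<comment> \<open>A homomorphism commutes with powers, so the additive constant does not depend on
    \<open>n\<close>.\<close>
  have pow: "length (\<theta> g [^]\<^bsub>free_group A\<^esub> n) \<le> n * length g + (C + 2 * length v)"
    if g: "g \<in> carrier (free_group A)" for g and n :: nat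
    using len [of "g [^]\<^bsub>free_group A\<^esub> n"] length_pow [of A g n] g T.hom_nat_pow [OF g, of n] by simp
  have letter: "length (\<theta> (gen a)) = 1" if "a \<in> A" for a
  proof (rule conj_minimal_letters [of A "\<lambda>a. \<theta> (gen a)" A "C + 2 * length v"])
    fix a assume a: "a \<in> A"
    show "\<theta> (gen a) \<in> carrier (free_group A)" using gen_in_free_group [OF a] by simp
    show "\<theta> (gen a) \<noteq> []"
    proof
      assume "\<theta> (gen a) = []"
      then have "\<theta> (gen a) = \<theta> \<one>\<^bsub>free_group A\<^esub>" using T.hom_one by (simp add: free_group_one)
      then have "gen a = \<one>\<^bsub>free_group A\<^esub>"
        using inj_onD [OF auto_inj [OF \<theta>]] gen_in_free_group [OF a] F.one_closed by blast
      then show False by (simp add: gen_def free_group_one)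
    qed
    show "length (\<theta> (gen a) [^]\<^bsub>free_group A\<^esub> n) \<le> n + (C + 2 * length v)" for n :: nat
      using pow [OF gen_in_free_group [OF a], of n] by simp
  next
    fix a b and n :: nat assume ab: "a \<in> A" "b \<in> A"
    let ?g = "gen a \<otimes>\<^bsub>free_group A\<^esub> gen b"
    have n2: "n * length ?g \<le> n * 2" using length_mult [of A "gen a" "gen b"] by (intro mult_le_mono2) simp
    have g: "?g \<in> carrier (free_group A)" using gen_in_free_group ab by (intro F.m_closed)
    have "\<theta> ?g = \<theta> (gen a) \<otimes>\<^bsub>free_group A\<^esub> \<theta> (gen b)"
      using gen_in_free_group ab by (intro T.hom_mult)
    then show "length ((\<theta> (gen a) \<otimes>\<^bsub>free_group A\<^esub> \<theta> (gen b)) [^]\<^bsub>free_group A\<^esub> n)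
        \<le> n * 2 + (C + 2 * length v)"
      using order_trans [OF pow [OF g, of n] add_right_mono [OF n2]] by simp
  next
    fix u assume u: "u \<in> carrier (free_group A)"
    have "(\<Sum>a\<in>A. length (\<theta> (gen a))) = (\<Sum>a\<in>A. length (inner (free_group A) v (\<psi> (gen a))))"
      by (simp add: \<theta>_apply gen_in_free_group)
    \<comment> \<open>Conjugating by \<open>v\<close> and then by \<open>u\<close> is conjugating by
      their product, so minimality of \<open>v\<close> for \<psi> says that no further conjugation
      shortens \<theta>.\<close>
    also have "\<dots> \<le> (\<Sum>a\<in>A. length (inner (free_group A) (v \<otimes>\<^bsub>free_group A\<^esub> u) (\<psi> (gen a))))"
      using vmin v u by simp
    also have "\<dots> = (\<Sum>a\<in>A. length (inner (free_group A) u (\<theta> (gen a))))"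
      using v u by (simp add: \<theta>_apply gen_in_free_group F.inner_inner auto_closed [OF \<psi>])
    finally show "(\<Sum>a\<in>A. length (\<theta> (gen a))) \<le> (\<Sum>a\<in>A. length (inv\<^bsub>free_group A\<^esub> u
        \<otimes>\<^bsub>free_group A\<^esub> \<theta> (gen a) \<otimes>\<^bsub>free_group A\<^esub> u))"
      by (simp add: inner_def gen_in_free_group)
  qed (use assms that in auto)
  have "\<theta> x \<in> sym_gens A" if "x \<in> sym_gens A" for x
  proof -
    have "length (\<theta> (inv\<^bsub>free_group A\<^esub> gen a)) = 1" if "a \<in> A" for a
      using letter [OF that] length_inv [of "\<theta> (gen a)" A] gen_in_free_group [OF that] by simp
    then have "length (\<theta> x) = 1"
      using \<open>x \<in> sym_gens A\<close> letter by (auto simp: sym_gens_def)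
    then show ?thesis using that by (simp add: sym_gens_iff)
  qed
  moreover have "inj_on \<theta> (sym_gens A)"
    using auto_inj [OF \<theta>] by (rule inj_on_subset) (auto simp: sym_gens_iff)
  moreover have "finite (sym_gens A)" using \<open>finite A\<close> by (simp add: sym_gens_def)
  \<comment> \<open>On the finite set of letters and their inverses, injectivity yields
    surjectivity.\<close>
  ultimately have "bij_betw \<theta> (sym_gens A) (sym_gens A)"
    using endo_inj_surj [of "sym_gens A" \<theta>] by (auto simp: bij_betw_def)
  with \<theta> have \<theta>P: "\<theta> \<in> Per A" by (simp add: Per_def)
  have "\<theta> = inv\<^bsub>?R\<^esub> \<phi> \<otimes>\<^bsub>?R\<^esub> inner (free_group A) v" by (simp add: \<theta>_def \<psi>_def)
  \<comment> \<open>Solving for \<phi> puts the inner factor first; normality exchanges the factors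
    at the end.\<close>
  then have "\<phi> = inner (free_group A) v \<otimes>\<^bsub>?R\<^esub> inv\<^bsub>?R\<^esub> \<theta>"
    using \<phi> iv by (simp add: R.inv_mult_group R.m_assoc [symmetric])
  moreover have "inv\<^bsub>?R\<^esub> \<theta> \<in> Per A"
    using subgroup.m_inv_closed [OF Per_subgroup \<theta>P] .
  ultimately have "\<phi> \<in> Inn (free_group A) <#>\<^bsub>?R\<^esub> Per A"
    using F.inner_in_Inn [OF v] by (auto simp: set_mult_def)
  then show ?thesis
    using R.commut_normal [OF Per_subgroup F.Inn_normal] by simp
qed

section \<open>The Lipschitz condition in terms of word length\<close>

text \<open>The subtracted fraction is the Gromov product at the identity. Moving the base point to
  \<open>p\<close> changes two distances by at most \<open>length p\<close> each, and only half
  their sum enters.\<close>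

lemma gromov_product_base:
  assumes p: "p \<in> carrier (free_group A)" and g: "g \<in> carrier (free_group A)" and h: "h \<in> carrier (free_group A)"
  shows "\<bar>gromov_product A p g h - (real (length g) + real (length h) - word_dist A g h) / 2\<bar>
    \<le> real (length p)"
proof -
  have *: "\<bar>word_dist A p x - real (length x)\<bar> \<le> real (length p)" if x: "x \<in> carrier (free_group A)" for x
  proof -
    have "p \<otimes>\<^bsub>free_group A\<^esub> (inv\<^bsub>free_group A\<^esub> p \<otimes>\<^bsub>free_group A\<^esub> x) = x"
      using p x by (simp add: F.m_assoc [symmetric])
    then show ?thesis
      using length_mult [of A "inv\<^bsub>free_group A\<^esub> p" x] length_inv [OF p]
        length_mult [of A p "inv\<^bsub>free_group A\<^esub> p \<otimes>\<^bsub>free_group A\<^esub> x"]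
      by (simp add: word_dist_def)
  qed
  show ?thesis
    using * [OF g] * [OF h] unfolding gromov_product_def by (simp add: abs_le_iff field_simps)
qed

lemma word_dist_auto:
  assumes "\<phi> \<in> auto (free_group A)" "g \<in> carrier (free_group A)" "h \<in> carrier (free_group A)"
  shows "word_dist A (\<phi> g) (\<phi> h) = real (length (\<phi> (inv\<^bsub>free_group A\<^esub> g \<otimes>\<^bsub>free_group A\<^esub> h)))"
proof -
  interpret P: group_hom "free_group A" "free_group A" \<phi> by (rule F.auto_hom [OF assms(1)])
  show ?thesis using assms by (simp add: word_dist_def)
qed

text \<open>This is the triangle inequality through the identity; it bounds the Gromov product at
  the identity by \<open>length g\<close>.\<close>

lemma word_dist_ge:
  assumes "g \<in> carrier (free_group A)" "h \<in> carrier (free_group A)"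
  shows "real (length h) - real (length g) \<le> word_dist A g h"
proof -
  have "g \<otimes>\<^bsub>free_group A\<^esub> (inv\<^bsub>free_group A\<^esub> g \<otimes>\<^bsub>free_group A\<^esub> h) = h"
    using assms by (simp add: F.m_assoc [symmetric])
  then show ?thesis
    using length_mult [of A g "inv\<^bsub>free_group A\<^esub> g \<otimes>\<^bsub>free_group A\<^esub> h"] by (simp add: word_dist_def)
qed

text \<open>Visual metrics are exponentials of Gromov products up to a factor, so taking logarithms
  turns the Lipschitz bound into an additive one.\<close>

lemma lipschitz_imp_gromov_le:
  assumes "\<gamma> > 0" "T \<ge> 1" and d: "d \<in> visual_metrics A p \<gamma> T" and \<phi>: "\<phi> \<in> auto (free_group A)"
    and "lipschitz_condition (carrier (free_group A)) d \<phi>"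
  shows "\<exists>C. \<forall>g\<in>carrier (free_group A). \<forall>h\<in>carrier (free_group A). g \<noteq> h \<longrightarrow>
    gromov_product A p g h \<le> gromov_product A p (\<phi> g) (\<phi> h) + C"
proof -
  obtain K where "K > 0" and K: "\<And>g h. g \<in> carrier (free_group A) \<Longrightarrow> h \<in> carrier (free_group A) \<Longrightarrow>
      d (\<phi> g) (\<phi> h) \<le> K * d g h"
    using assms by (auto simp: lipschitz_condition_def)
  \<comment> \<open>The visual bounds cost one factor \<open>T\<close> for the images and one for
    \<open>g\<close> and \<open>h\<close>; together with \<open>K\<close> they become additive under
    the logarithm, divided by the rate \<gamma>.\<close>
  have "gromov_product A p g h \<le> gromov_product A p (\<phi> g) (\<phi> h) + ln (K * T\<^sup>2) / \<gamma>"
    if g: "g \<in> carrier (free_group A)" and h: "h \<in> carrier (free_group A)" and "g \<noteq> h" for g h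
  proof -
    let ?P = "gromov_product A p g h" and ?Q = "gromov_product A p (\<phi> g) (\<phi> h)"
    have ne: "\<phi> g \<noteq> \<phi> h" using inj_onD [OF auto_inj [OF \<phi>] _ g h] \<open>g \<noteq> h\<close> by blast
    have "1 / T * exp (- \<gamma> * ?Q) \<le> d (\<phi> g) (\<phi> h)"
      using d ne auto_closed [OF \<phi> g] auto_closed [OF \<phi> h] by (auto simp: visual_metrics_def visual_rho_def)
    also have "\<dots> \<le> K * d g h" by (rule K [OF g h])
    also have "\<dots> \<le> K * (T * exp (- \<gamma> * ?P))"
      using d g h \<open>g \<noteq> h\<close> \<open>K > 0\<close>
      by (intro mult_left_mono) (auto simp: visual_metrics_def visual_rho_def)
    finally have "exp (- \<gamma> * ?Q) \<le> K * T\<^sup>2 * exp (- \<gamma> * ?P)"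
      using \<open>T \<ge> 1\<close> by (simp add: field_simps power2_eq_square)
    also have "\<dots> = exp (ln (K * T\<^sup>2) - \<gamma> * ?P)"
      using \<open>K > 0\<close> \<open>T \<ge> 1\<close> by (simp add: exp_diff exp_minus field_simps)
    finally have "- \<gamma> * ?Q \<le> ln (K * T\<^sup>2) - \<gamma> * ?P" by simp
    then show ?thesis using \<open>\<gamma> > 0\<close> by (simp add: field_simps)
  qed
  then show ?thesis by blast
qed

text \<open>A nonempty \<open>g\<close> is tested against a one-letter extension: at the identity
  their Gromov product is exactly \<open>length g\<close>, while that of the images is at most
  \<open>length (\<phi> g)\<close>.\<close>

lemma lipschitz_imp_length_ge:
  assumes p: "p \<in> carrier (free_group A)" and "\<gamma> > 0" "T \<ge> 1" and d: "d \<in> visual_metrics A p \<gamma> T"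
    and \<phi>: "\<phi> \<in> auto (free_group A)" and lip: "lipschitz_condition (carrier (free_group A)) d \<phi>"
  shows "\<exists>C. \<forall>g\<in>carrier (free_group A). length g \<le> length (\<phi> g) + C"
proof -
  obtain C where C: "\<And>g h. g \<in> carrier (free_group A) \<Longrightarrow> h \<in> carrier (free_group A) \<Longrightarrow> g \<noteq> h \<Longrightarrow>
    gromov_product A p g h \<le> gromov_product A p (\<phi> g) (\<phi> h) + C"
    using lipschitz_imp_gromov_le [OF \<open>\<gamma> > 0\<close> \<open>T \<ge> 1\<close> d \<phi> lip] by blast
  \<comment> \<open>Each of the two changes of base point costs \<open>length p\<close>.\<close>
  have "length g \<le> length (\<phi> g) + nat \<lceil>C + 2 * real (length p)\<rceil>" if g: "g \<in> carrier (free_group A)" for g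
  proof (cases "g = []")
    case False
    \<comment> \<open>Repeating the last letter never cancels.\<close>
    let ?h = "g @ [last g]"
    have x: "[last g] \<in> carrier (free_group A)"
      using g False last_in_set [of g] by (auto simp: free_group_carrier_iff reduced_Cons)
    have h: "?h \<in> carrier (free_group A)"
      using g x by (auto simp: free_group_carrier_iff reduced_append_iff)
    have "?h = g \<otimes>\<^bsub>free_group A\<^esub> [last g]"
      using h by (simp add: free_group_mult reduce_id free_group_carrier_iff)
    then have "inv\<^bsub>free_group A\<^esub> g \<otimes>\<^bsub>free_group A\<^esub> ?h = [last g]"
      using g x by (simp add: F.m_assoc [symmetric])
    then have "word_dist A g ?h = 1" by (simp add: word_dist_def)
    then have "real (length g) - real (length p) \<le> gromov_product A p g ?h"
      using gromov_product_base [OF p g h] by (simp add: abs_le_iff)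
    also have "\<dots> \<le> gromov_product A p (\<phi> g) (\<phi> ?h) + C" by (rule C [OF g h]) simp
    also have "gromov_product A p (\<phi> g) (\<phi> ?h) \<le> real (length (\<phi> g)) + real (length p)"
      using gromov_product_base [OF p auto_closed [OF \<phi> g] auto_closed [OF \<phi> h]]
        word_dist_ge [OF auto_closed [OF \<phi> g] auto_closed [OF \<phi> h]]
      by (simp add: abs_le_iff field_simps)
    finally show ?thesis by linarith
  qed simp
  then show ?thesis by blast
qed

text \<open>Bounded distortion of lengths bounds the decrease of Gromov products, and exponentiating
  gives the Lipschitz constant.\<close>

lemma length_bounded_imp_lipschitz:
  assumes p: "p \<in> carrier (free_group A)" and "\<gamma> > 0" "T \<ge> 1" and d: "d \<in> visual_metrics A p \<gamma> T"
    and \<phi>: "\<phi> \<in> auto (free_group A)"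
    and C: "\<And>g. g \<in> carrier (free_group A) \<Longrightarrow> \<bar>real (length (\<phi> g)) - real (length g)\<bar> \<le> C"
  shows "lipschitz_condition (carrier (free_group A)) d \<phi>"
proof -
  \<comment> \<open>Two changes of base point cost \<open>length p\<close> each, and each of the two
    lengths and the distance in the Gromov product contributes half of \<open>C\<close>.\<close>
  define B where "B = 2 * real (length p) + 3 * C / 2"
  have "d (\<phi> g) (\<phi> h) \<le> T\<^sup>2 * exp (\<gamma> * B) * d g h"
    if g: "g \<in> carrier (free_group A)" and h: "h \<in> carrier (free_group A)" for g h
  proof (cases "g = h")
    case True
    then show ?thesis
      using d g auto_closed [OF \<phi> g] Metric_space.mdist_zero [of "carrier (free_group A)" d]
      by (simp add: visual_metrics_def)
  next
    case False
    let ?P = "gromov_product A p g h" and ?Q = "gromov_product A p (\<phi> g) (\<phi> h)"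
    have ne: "\<phi> g \<noteq> \<phi> h" using inj_onD [OF auto_inj [OF \<phi>] _ g h] False by blast
    \<comment> \<open>Distances are lengths of quotients, so the length bound is applied to the
      quotient of \<open>g\<close> and \<open>h\<close>.\<close>
    have "\<bar>word_dist A (\<phi> g) (\<phi> h) - word_dist A g h\<bar> \<le> C"
      using C [of "inv\<^bsub>free_group A\<^esub> g \<otimes>\<^bsub>free_group A\<^esub> h"] g h word_dist_auto [OF \<phi> g h]
      by (simp add: word_dist_def)
    then have "?P \<le> ?Q + B"
      using gromov_product_base [OF p g h] C [OF g] C [OF h]
        gromov_product_base [OF p auto_closed [OF \<phi> g] auto_closed [OF \<phi> h]]
      unfolding B_def by (simp add: abs_le_iff field_simps)
    then have "\<gamma> * ?P \<le> \<gamma> * (?Q + B)" using \<open>\<gamma> > 0\<close> by (intro mult_left_mono) auto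
    then have le: "exp (- \<gamma> * ?Q) \<le> exp (\<gamma> * B) * exp (- \<gamma> * ?P)"
      by (simp add: exp_add [symmetric] algebra_simps)
    have "d (\<phi> g) (\<phi> h) \<le> T * exp (- \<gamma> * ?Q)"
      using d ne auto_closed [OF \<phi> g] auto_closed [OF \<phi> h] by (auto simp: visual_metrics_def visual_rho_def)
    also have "\<dots> \<le> T * (exp (\<gamma> * B) * exp (- \<gamma> * ?P))"
      using le \<open>T \<ge> 1\<close> by (intro mult_left_mono) auto
    also have "\<dots> = T\<^sup>2 * exp (\<gamma> * B) * (1 / T * exp (- \<gamma> * ?P))"
      using \<open>T \<ge> 1\<close> by (simp add: power2_eq_square)
    also have "\<dots> \<le> T\<^sup>2 * exp (\<gamma> * B) * d g h"
      using d g h False by (intro mult_left_mono) (auto simp: visual_metrics_def visual_rho_def)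
    finally show ?thesis .
  qed
  moreover have "T\<^sup>2 * exp (\<gamma> * B) > 0" using \<open>T \<ge> 1\<close> by simp
  ultimately show ?thesis unfolding lipschitz_condition_def by blast
qed

theorem theorem6p4:
  fixes A :: "'a set"
    and p :: "'a word"
    and \<gamma> T :: real
    and d :: "'a word \<Rightarrow> 'a word \<Rightarrow> real"
    and \<phi> :: "'a word \<Rightarrow> 'a word"
  assumes "finite A"
    and "p \<in> carrier (free_group A)"
    and "\<gamma> > 0"
    and "T \<ge> 1"
    and "d \<in> visual_metrics A p \<gamma> T"
    and "\<phi> \<in> auto (free_group A)"
  shows "(lipschitz_condition (carrier (free_group A)) d \<phi> \<longleftrightarrow>
            \<phi> \<in> generate (right_AutoGroup (free_group A)) (Inn (free_group A) \<union> Per A))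
       \<and> generate (right_AutoGroup (free_group A)) (Inn (free_group A) \<union> Per A)
            = Per A <#>\<^bsub>right_AutoGroup (free_group A)\<^esub> Inn (free_group A)"
proof -
  have gen: "generate (right_AutoGroup (free_group A)) (Inn (free_group A) \<union> Per A)
      = Per A <#>\<^bsub>right_AutoGroup (free_group A)\<^esub> Inn (free_group A)"
    by (rule group.generate_normal_Un [OF F.group_right_AutoGroup F.Inn_normal Per_subgroup])
  \<comment> \<open>A one-sided length bound suffices here; the converse direction uses a two-sided
    one.\<close>
  moreover have "\<phi> \<in> Per A <#>\<^bsub>right_AutoGroup (free_group A)\<^esub> Inn (free_group A)"
    if lip: "lipschitz_condition (carrier (free_group A)) d \<phi>"
    using lipschitz_imp_length_ge [OF assms(2-6) lip] Per_Inn_if_length_ge [OF assms(1,6)] by blast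
  moreover have "lipschitz_condition (carrier (free_group A)) d \<phi>"
    if "\<phi> \<in> Per A <#>\<^bsub>right_AutoGroup (free_group A)\<^esub> Inn (free_group A)"
    using Per_Inn_length [OF that] length_bounded_imp_lipschitz [OF assms(2-6)] by blast
  ultimately show ?thesis by blast
qed

end
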